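(* Let $c$ be a fixed positive integer. For each positive integer $n$ with $c\mid 2n$ and $2n/c\ge 2$, let $K_{(2n/c)\times c}$ be the complete multipartite graph on $2n$ vertices with $2n/c$ partition classes of $c$ vertices each, and let $M=M_n$ be a perfect matching in $K_{(2n/c)\times c}$. Then $$\lim_{\substack{n\to\infty\\ c\mid 2n}}\frac{\mathrm{pm}(K_{(2n/c)\times c}-M)}{\mathrm{pm}(K_{(2n/c)\times c})}=e^{-1/2}.$$
   Context: Graphs are finite and simple, with labelled vertices. For a graph $G$, $\mathrm{pm}(G)$ denotes the number of perfect matchings of $G$. For a set $M$ of edges of $G$, $G-M$ is the graph with the same vertex set as $G$ and edge set $E(G)\setminus M$. The complete multipartite graph has as its edges exactly all pairs of vertices lying in different partition classes. The limit is taken as $n\to\infty$ through integers $n$ with $c\mid 2n$, and is asserted for every choice of the perfect matchings $M_n$. *)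

theory Defs
  imports Complex_Main
begin

record 'a ugraph =
  verts :: "'a set"
  edges :: "'a set set"

definition simple_graph :: "'a ugraph \<Rightarrow> bool" where
  "simple_graph G \<longleftrightarrow> finite (verts G) \<and> (\<forall>e\<in>edges G. e \<subseteq> verts G \<and> card e = 2)"

definition perfect_matching :: "'a ugraph \<Rightarrow> 'a set set \<Rightarrow> bool" where
  "perfect_matching G M \<longleftrightarrow> M \<subseteq> edges G \<and> (\<forall>v\<in>verts G. \<exists>!e. e \<in> M \<and> v \<in> e)"

definition pm :: "'a ugraph \<Rightarrow> nat" where
  "pm G = card {M. perfect_matching G M}"

definition remove_edges :: "'a ugraph \<Rightarrow> 'a set set \<Rightarrow> 'a ugraph" where
  "remove_edges G M = \<lparr>verts = verts G, edges = edges G - M\<rparr>"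

(* The vertex (i, j) is the j-th vertex of the i-th partition class; there are r classes of size c. *)
definition complete_multipartite :: "nat \<Rightarrow> nat \<Rightarrow> (nat \<times> nat) ugraph" where
  "complete_multipartite r c =
     \<lparr>verts = {..<r} \<times> {..<c},
      edges = {{u, v} |u v. u \<in> {..<r} \<times> {..<c} \<and> v \<in> {..<r} \<times> {..<c} \<and> fst u \<noteq> fst v}\<rparr>"

lemma simple_graph_complete_multipartite: "simple_graph (complete_multipartite r c)"
  by (auto simp: simple_graph_def complete_multipartite_def card_2_iff)

lemma card_verts_complete_multipartite: "card (verts (complete_multipartite r c)) = r * c"
  by (simp add: complete_multipartite_def)

lemma simple_graph_remove_edges: "simple_graph G \<Longrightarrow> simple_graph (remove_edges G M)"
  by (simp add: simple_graph_def remove_edges_def)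

lemma finite_perfect_matchings:
  assumes "simple_graph G"
  shows "finite {M. perfect_matching G M}"
proof -
  have "edges G \<subseteq> Pow (verts G)" "finite (verts G)"
    using assms by (auto simp: simple_graph_def)
  then have "finite (Pow (edges G))"
    by (meson finite_Pow_iff finite_subset)
  moreover have "{M. perfect_matching G M} \<subseteq> Pow (edges G)"
    by (auto simp: perfect_matching_def)
  ultimately show ?thesis by (rule finite_subset[rotated])
qed

end

theory Submission
  imports Defs "HOL-Library.Disjoint_Sets" "HOL-Real_Asymp.Real_Asymp"
begin

text \<open>
  Write \<open>f W\<close> for the number of perfect matchings of the complete multipartite graph induced on
  a vertex set \<open>W\<close>. Expanding along a vertex gives a recursion for \<open>f\<close>, and comparing the
  expansions along different vertices yields \<open>f (W - {a, b}) / f W = (1 + O(1 / |W|)) / |W|\<close>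
  uniformly in adjacent \<open>a\<close>, \<open>b\<close>, as long as the classes have bounded size. Hence a uniformly
  random perfect matching contains any given \<open>k\<close> edges of \<open>M\<close> with probability asymptotic to
  \<open>(2 n)\<^sup>-\<^sup>k\<close>, and the \<open>k\<close>-th binomial moment of the number of edges shared with \<open>M\<close> tends to
  \<open>1 / (2\<^sup>k k!)\<close>, the moment of a Poisson variable with mean \<open>1 / 2\<close>. The Bonferroni
  inequalities turn this into the limit \<open>exp (- 1 / 2)\<close> of the probability of sharing no edge.
\<close>

section \<open>Matchings of complete multipartite graphs on arbitrary vertex sets\<close>

text \<open>The classes come from a map \<open>cl\<close>, so deleting vertices only shrinks
  \<open>W\<close> and keeps \<open>cl\<close>: the expansions below stay within this family
  although the classes become unequal.\<close>

definition class_graph :: "('a \<Rightarrow> 'b) \<Rightarrow> 'a set \<Rightarrow> 'a ugraph" where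
  "class_graph cl W = \<lparr>verts = W, edges = {{u, v} |u v. u \<in> W \<and> v \<in> W \<and> cl u \<noteq> cl v}\<rparr>"

lemma verts_class_graph [simp]: "verts (class_graph cl W) = W"
  by (simp add: class_graph_def)

lemma edges_class_graph: "edges (class_graph cl W) = {{u, v} |u v. u \<in> W \<and> v \<in> W \<and> cl u \<noteq> cl v}"
  by (simp add: class_graph_def)

lemma complete_multipartite_eq_class_graph:
  "complete_multipartite r c = class_graph fst ({..<r} \<times> {..<c})"
  by (simp add: complete_multipartite_def class_graph_def)

lemma simple_class_graph: "finite W \<Longrightarrow> simple_graph (class_graph cl W)"
  by (auto simp: simple_graph_def edges_class_graph card_2_iff)

lemma edges_class_graph_Diff:
  "edges (class_graph cl (W - X)) = {e \<in> edges (class_graph cl W). e \<inter> X = {}}"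
  by (auto simp: edges_class_graph)

lemma perfect_matching_disjoint:
  assumes "simple_graph G" "perfect_matching G P"
  shows "disjoint P"
proof (rule disjointI)
  fix e e' assume "e \<in> P" "e' \<in> P" "e \<noteq> e'"
  with assms show "e \<inter> e' = {}"
    unfolding simple_graph_def perfect_matching_def by blast
qed

lemma Union_perfect_matching:
  assumes "simple_graph G" "perfect_matching G P"
  shows "\<Union>P = verts G"
  using assms unfolding simple_graph_def perfect_matching_def by blast

lemma finite_perfect_matching:
  assumes "simple_graph G" "perfect_matching G P"
  shows "finite P"
  using Union_perfect_matching[OF assms] assms(1) by (metis finite_UnionD simple_graph_def)

lemma card_Union_disjoint_edges:
  assumes "simple_graph G" "S \<subseteq> edges G" "disjoint S"
  shows "card (\<Union>S) = 2 * card S"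
proof -
  have *: "finite e \<and> card e = 2" if "e \<in> S" for e
    using assms that unfolding simple_graph_def by (meson finite_subset subsetD)
  then have "card (\<Union>S) = sum card S"
    using assms(3) by (intro card_Union_disjoint) (auto simp: disjoint_def pairwise_def disjnt_def)
  also have "\<dots> = 2 * card S"
    using * by simp
  finally show ?thesis .
qed

text \<open>The bijection removes \<open>S\<close> from a matching and its inverse adds
  \<open>S\<close> back; as \<open>S\<close> is disjoint, each vertex of \<open>\<Union>S\<close> is
  then covered only once.\<close>

lemma card_perfect_matchings_containing:
  assumes fin: "finite W" and S: "S \<subseteq> edges (class_graph cl W)" "disjoint S"
  shows "card {P. perfect_matching (class_graph cl W) P \<and> S \<subseteq> P} = pm (class_graph cl (W - \<Union>S))"
proof -
  let ?A = "{P. perfect_matching (class_graph cl W) P \<and> S \<subseteq> P}"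
  let ?B = "{Q. perfect_matching (class_graph cl (W - \<Union>S)) Q}"
  have "bij_betw (\<lambda>P. P - S) ?A ?B"
  proof (rule bij_betw_byWitness[where f' = "\<lambda>Q. Q \<union> S"])
    show "\<forall>P\<in>?A. P - S \<union> S = P" by auto
    have ne: "e \<noteq> {}" if "e \<in> edges (class_graph cl W)" for e
      using that by (auto simp: edges_class_graph)
    \<comment> \<open>Edges of \<open>Q\<close> avoid \<open>\<Union>S\<close>, so an edge common to
      \<open>Q\<close> and \<open>S\<close> would be empty.\<close>
    have "Q \<inter> S = {}" if "Q \<in> ?B" for Q
    proof (rule ccontr)
      assume "Q \<inter> S \<noteq> {}"
      then obtain e where e: "e \<in> Q" "e \<in> S" by auto
      then have "e \<inter> \<Union>S = {}" "e \<in> edges (class_graph cl W)"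
        using that unfolding perfect_matching_def edges_class_graph_Diff by auto
      then show False using e(2) ne by blast
    qed
    then show "\<forall>Q\<in>?B. Q \<union> S - S = Q" by auto
    show "(\<lambda>P. P - S) ` ?A \<subseteq> ?B"
    proof clarify
      fix P assume P: "perfect_matching (class_graph cl W) P" "S \<subseteq> P"
      have d: "disjoint P"
        using perfect_matching_disjoint simple_class_graph fin P by blast
      have "P - S \<subseteq> edges (class_graph cl (W - \<Union>S))"
      proof
        fix e assume e: "e \<in> P - S"
        then have "e \<inter> s = {}" if "s \<in> S" for s
          using d P(2) that by (intro disjointD[OF d]) auto
        then show "e \<in> edges (class_graph cl (W - \<Union>S))"
          using e P(1) unfolding perfect_matching_def edges_class_graph_Diff by auto
      qed
      moreover have "\<exists>!e. e \<in> P - S \<and> v \<in> e" if v: "v \<in> W - \<Union>S" for v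
      proof -
        have "\<exists>!e. e \<in> P \<and> v \<in> e" using P(1) v by (simp add: perfect_matching_def)
        moreover have "e \<in> P - S \<and> v \<in> e \<longleftrightarrow> e \<in> P \<and> v \<in> e" for e using v by auto
        ultimately show ?thesis by simp
      qed
      ultimately show "perfect_matching (class_graph cl (W - \<Union>S)) (P - S)"
        by (simp add: perfect_matching_def)
    qed
    show "(\<lambda>Q. Q \<union> S) ` ?B \<subseteq> ?A"
    proof clarify
      fix Q assume Q: "perfect_matching (class_graph cl (W - \<Union>S)) Q"
      then have Q': "Q \<subseteq> edges (class_graph cl W)" "\<And>e. e \<in> Q \<Longrightarrow> e \<inter> \<Union>S = {}"
        unfolding perfect_matching_def edges_class_graph_Diff by auto
      have "\<exists>!e. e \<in> Q \<union> S \<and> v \<in> e" if "v \<in> W" for v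
      proof (cases "v \<in> \<Union>S")
        case True
        then obtain e where e: "e \<in> S" "v \<in> e" by auto
        show ?thesis
          by (rule ex1I[of _ e]) (use e Q'(2) S(2) in \<open>auto simp: disjoint_def\<close>)
      next
        case False
        then have "\<exists>!e. e \<in> Q \<and> v \<in> e"
          using Q that by (simp add: perfect_matching_def)
        then show ?thesis using False by blast
      qed
      then show "perfect_matching (class_graph cl W) (Q \<union> S) \<and> S \<subseteq> Q \<union> S"
        using Q' S(1) by (simp add: perfect_matching_def)
    qed
  qed
  then show ?thesis by (simp add: pm_def bij_betw_same_card)
qed

section \<open>Vertex expansion and ratio bounds for deleting edges\<close>

text \<open>The partner \<open>x\<close> of \<open>u\<close> splits the perfect matchings into
  disjoint families, each counted by \<open>card_perfect_matchings_containing\<close> for the single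
  edge \<open>{u, x}\<close>.\<close>

lemma pm_class_graph_rec:
  assumes fin: "finite W" and u: "u \<in> W"
  shows "pm (class_graph cl W) = (\<Sum>x\<in>{x\<in>W. cl x \<noteq> cl u}. pm (class_graph cl (W - {u, x})))"
proof -
  let ?G = "class_graph cl W"
  let ?X = "{x\<in>W. cl x \<noteq> cl u}"
  let ?A = "\<lambda>x. {P. perfect_matching ?G P \<and> {{u, x}} \<subseteq> P}"
  have sg: "simple_graph ?G" using fin by (rule simple_class_graph)
  have "{P. perfect_matching ?G P} \<subseteq> (\<Union>x\<in>?X. ?A x)"
  proof clarify
    fix P assume P: "perfect_matching ?G P"
    then obtain e where e: "e \<in> P" "u \<in> e" using u by (auto simp: perfect_matching_def)
    then have "e \<in> edges ?G" using P by (auto simp: perfect_matching_def)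
    then obtain x where "e = {u, x}" "x \<in> ?X"
      using e(2) unfolding edges_class_graph by (fastforce simp: doubleton_eq_iff)
    then show "P \<in> (\<Union>x\<in>?X. ?A x)" using P e by auto
  qed
  then have "pm ?G = card (\<Union>x\<in>?X. ?A x)"
    unfolding pm_def by (intro arg_cong[where f = card]) auto
  also have "\<dots> = (\<Sum>x\<in>?X. card (?A x))"
  proof (rule card_UN_disjoint)
    show "\<forall>x\<in>?X. finite (?A x)"
      using finite_perfect_matchings[OF sg] by (auto intro: finite_subset[rotated])
    show "\<forall>x\<in>?X. \<forall>y\<in>?X. x \<noteq> y \<longrightarrow> ?A x \<inter> ?A y = {}"
    proof (intro ballI impI, rule ccontr)
      fix x y assume xy: "x \<in> ?X" "y \<in> ?X" "x \<noteq> y" and "?A x \<inter> ?A y \<noteq> {}"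
      then obtain P where P: "perfect_matching ?G P" "{u, x} \<in> P" "{u, y} \<in> P" by auto
      then have "{u, x} = {u, y}"
        using u unfolding perfect_matching_def verts_class_graph by blast
      then show False using xy by (auto simp: doubleton_eq_iff)
    qed
  qed (use fin in auto)
  also have "\<dots> = (\<Sum>x\<in>?X. pm (class_graph cl (W - {u, x})))"
  proof (rule sum.cong)
    fix x assume "x \<in> ?X"
    then have "{{u, x}} \<subseteq> edges ?G" using u by (auto simp: edges_class_graph)
    then show "card (?A x) = pm (class_graph cl (W - {u, x}))"
      using card_perfect_matchings_containing[OF fin, of "{{u, x}}"] by simp
  qed simp
  finally show ?thesis .
qed

text \<open>
  Expand \<open>f W\<close> along \<open>a\<close> and then \<open>b\<close>, with partners \<open>x\<close> and \<open>y\<close>. The resulting terms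
  \<open>f (W - {a, b, x, y})\<close> also occur in the sum over \<open>x\<close> of the expansions of \<open>f (W - {a, b})\<close>
  along \<open>x\<close>; the latter has additional terms only for \<open>x\<close> in the class of \<open>a\<close> or \<open>y\<close> in
  the class of \<open>b\<close>.
\<close>

lemma pm_class_graph_remove_two_le:
  fixes cl :: "'a \<Rightarrow> 'b"
  assumes fin: "finite W" and c: "\<And>x. card {y\<in>W. cl y = cl x} \<le> c"
    and ab: "a \<in> W" "b \<in> W" "a \<noteq> b"
  shows "(real (card W) - 2 - 2 * real c) * real (pm (class_graph cl (W - {a, b})))
    \<le> real (pm (class_graph cl W))"
proof -
  define f where "f X = real (pm (class_graph cl X))" for X
  define V where "V = W - {a, b}"
  have finV: "finite V" using fin V_def by simp
  have f_nonneg: "f X \<ge> 0" for X by (simp add: f_def)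
  have rec: "f X = (\<Sum>x\<in>{x\<in>X. cl x \<noteq> cl u}. f (X - {u, x}))" if "finite X" "u \<in> X" for X u
    unfolding f_def by (subst pm_class_graph_rec[OF that]) simp
  have cV: "card {y\<in>V. cl y = cl x} \<le> c" for x
    by (rule order_trans[OF card_mono c[of x]]) (use fin in \<open>auto simp: V_def\<close>)
  let ?A = "{x\<in>V. cl x \<noteq> cl a}"
  have inner: "f V - (\<Sum>y\<in>{y\<in>V. cl y = cl b \<and> cl y \<noteq> cl x}. f (V - {x, y})) \<le> f (W - {a, x})"
    if x: "x \<in> ?A" for x
  proof -
    have "f V = (\<Sum>y\<in>{y\<in>V. cl y \<noteq> cl x}. f (V - {x, y}))"
      using x finV by (intro rec) auto
    also have "{y\<in>V. cl y \<noteq> cl x} = {y\<in>V. cl y = cl b \<and> cl y \<noteq> cl x} \<union> {y\<in>V. cl y \<noteq> cl b \<and> cl y \<noteq> cl x}"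
      by auto
    also have "(\<Sum>y\<in>\<dots>. f (V - {x, y})) = (\<Sum>y\<in>{y\<in>V. cl y = cl b \<and> cl y \<noteq> cl x}. f (V - {x, y}))
        + (\<Sum>y\<in>{y\<in>V. cl y \<noteq> cl b \<and> cl y \<noteq> cl x}. f (V - {x, y}))"
      using finV by (intro sum.union_disjoint) auto
    \<comment> \<open>Such a \<open>y\<close> differs from \<open>a\<close> and \<open>x\<close>, so
      it is an admissible partner of \<open>b\<close> in \<open>W - {a, x}\<close>.\<close>
    also have "(\<Sum>y\<in>{y\<in>V. cl y \<noteq> cl b \<and> cl y \<noteq> cl x}. f (V - {x, y}))
        \<le> (\<Sum>y\<in>{y\<in>W - {a, x}. cl y \<noteq> cl b}. f (V - {x, y}))"
      using fin by (intro sum_mono2) (auto simp: V_def f_nonneg)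
    also have "\<dots> = (\<Sum>y\<in>{y\<in>W - {a, x}. cl y \<noteq> cl b}. f (W - {a, x} - {b, y}))"
      unfolding V_def by (intro sum.cong arg_cong[where f = f]) auto
    also have "\<dots> = f (W - {a, x})"
      using fin ab x by (intro rec[symmetric]) (auto simp: V_def)
    finally show ?thesis by simp
  qed
  \<comment> \<open>After swapping the sums, the inner sum over \<open>x\<close> is part of the
    expansion of \<open>f V\<close> along \<open>y\<close>, and at most \<open>c\<close> vertices
    \<open>y\<close> share the class of \<open>b\<close>.\<close>
  have "(\<Sum>x\<in>?A. \<Sum>y\<in>{y\<in>V. cl y = cl b \<and> cl y \<noteq> cl x}. f (V - {x, y}))
      = (\<Sum>y\<in>{y\<in>V. cl y = cl b}. \<Sum>x\<in>{x\<in>?A. cl y \<noteq> cl x}. f (V - {x, y}))"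
    using sum.swap_restrict[of ?A "{y\<in>V. cl y = cl b}" "\<lambda>x y. f (V - {x, y})" "\<lambda>x y. cl y \<noteq> cl x"]
      finV by (simp add: conj_assoc)
  also have "\<dots> \<le> (\<Sum>y\<in>{y\<in>V. cl y = cl b}. f V)"
  proof (rule sum_mono)
    fix y assume y: "y \<in> {y\<in>V. cl y = cl b}"
    have "(\<Sum>x\<in>{x\<in>?A. cl y \<noteq> cl x}. f (V - {x, y})) \<le> (\<Sum>x\<in>{x\<in>V. cl x \<noteq> cl y}. f (V - {x, y}))"
      using finV by (intro sum_mono2) (auto simp: f_nonneg)
    also have "\<dots> = f V"
      using rec[OF finV, of y] y by (simp add: insert_commute)
    finally show "(\<Sum>x\<in>{x\<in>?A. cl y \<noteq> cl x}. f (V - {x, y})) \<le> f V" .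
  qed
  also have "\<dots> \<le> real c * f V"
    using cV[of b] by (simp add: mult_right_mono f_nonneg)
  finally have bad: "(\<Sum>x\<in>?A. \<Sum>y\<in>{y\<in>V. cl y = cl b \<and> cl y \<noteq> cl x}. f (V - {x, y})) \<le> real c * f V" .
  have "card V = card ?A + card {x\<in>V. cl x = cl a}"
    using finV by (subst card_Un_disjoint[symmetric]) (auto intro!: arg_cong[where f = card])
  moreover have "card W = card V + 2"
  proof -
    have "card {a, b} \<le> card W" using ab fin by (intro card_mono) auto
    then show ?thesis using ab fin unfolding V_def by (subst card_Diff_subset) auto
  qed
  \<comment> \<open>One \<open>c\<close> is lost here to the class of \<open>a\<close>; the surplus
    terms in \<open>bad\<close> cost the second.\<close>
  ultimately have A: "real (card W) - 2 - c \<le> card ?A"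
    using cV[of a] by linarith
  have "(real (card W) - 2 - c) * f V - c * f V \<le> card ?A * f V - c * f V"
    using A by (simp add: mult_right_mono f_nonneg)
  also have "\<dots> \<le> (\<Sum>x\<in>?A. f V - (\<Sum>y\<in>{y\<in>V. cl y = cl b \<and> cl y \<noteq> cl x}. f (V - {x, y})))"
    using bad by (simp add: sum_subtractf)
  also have "\<dots> \<le> (\<Sum>x\<in>?A. f (W - {a, x}))"
    by (intro sum_mono inner)
  also have "\<dots> \<le> (\<Sum>x\<in>{x\<in>W. cl x \<noteq> cl a}. f (W - {a, x}))"
    using fin by (intro sum_mono2) (auto simp: V_def f_nonneg)
  also have "\<dots> = f W"
    using fin ab by (intro rec[symmetric])
  finally show ?thesis
    by (simp add: f_def V_def algebra_simps)
qed

text \<open>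
  Each term \<open>f (W - {a, x})\<close> of the expansion along \<open>a\<close> exceeds \<open>f (W - {a, b})\<close> by little:
  expand the former along \<open>b\<close> and the latter along \<open>x\<close>.
\<close>

lemma pm_class_graph_le_remove_edge:
  fixes cl :: "'a \<Rightarrow> 'b"
  assumes fin: "finite W" and c: "\<And>x. card {y\<in>W. cl y = cl x} \<le> c"
    and ab: "a \<in> W" "b \<in> W" "cl a \<noteq> cl b"
    and D: "D > 0" "D + 4 + 2 * real c \<le> real (card W)"
  shows "real (pm (class_graph cl W))
    \<le> real (card W) * (1 + real c / D) * real (pm (class_graph cl (W - {a, b})))"
proof -
  define f where "f X = real (pm (class_graph cl X))" for X
  define V where "V = W - {a, b}"
  have finV: "finite V" using fin V_def by simp
  have f_nonneg: "f X \<ge> 0" for X by (simp add: f_def)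
  have rec: "f X = (\<Sum>x\<in>{x\<in>X. cl x \<noteq> cl u}. f (X - {u, x}))" if "finite X" "u \<in> X" for X u
    unfolding f_def by (subst pm_class_graph_rec[OF that]) simp
  have cV: "card {y\<in>V. cl y = cl x} \<le> c" for x
    by (rule order_trans[OF card_mono c[of x]]) (use fin in \<open>auto simp: V_def\<close>)
  have "card V = card W - 2"
    using ab fin unfolding V_def by (subst card_Diff_subset) (auto simp: card_insert_if)
  \<comment> \<open>Of the 4 in the hypothesis on \<open>D\<close>, 2 pays for passing from
    \<open>W\<close> to \<open>V\<close> and 2 for the loss in
    \<open>pm_class_graph_remove_two_le\<close> on \<open>V\<close>.\<close>
  then have DV: "D \<le> real (card V) - 2 - 2 * real c"
    using D by linarith
  have step: "f (W - {a, x}) \<le> (1 + real c / D) * f V" if x: "x \<in> W" "cl x \<noteq> cl a" for x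
  proof (cases "x = b")
    case True
    then show ?thesis using D f_nonneg[of V] by (simp add: V_def algebra_simps)
  next
    case False
    have xV: "x \<in> V" using x False by (auto simp: V_def)
    \<comment> \<open>Here \<open>w\<close> may lie in the class of \<open>x\<close>, so that
      \<open>{x, w}\<close> is no edge; \<open>pm_class_graph_remove_two_le\<close> covers this
      because it asks only for distinct vertices.\<close>
    have close: "f (V - {x, w}) \<le> f V / D" if "w \<in> V" "w \<noteq> x" for w
    proof -
      have "D * f (V - {x, w}) \<le> (real (card V) - 2 - 2 * real c) * f (V - {x, w})"
        using DV by (intro mult_right_mono f_nonneg)
      also have "\<dots> \<le> f V"
        unfolding f_def using xV that by (intro pm_class_graph_remove_two_le finV cV) auto
      finally show ?thesis using D by (simp add: field_simps)
    qed
    have "f (W - {a, x}) = (\<Sum>w\<in>{w\<in>W - {a, x}. cl w \<noteq> cl b}. f (W - {a, x} - {b, w}))"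
      using fin ab x False by (intro rec) auto
    also have "\<dots> = (\<Sum>w\<in>{w\<in>W - {a, x}. cl w \<noteq> cl b}. f (V - {x, w}))"
      unfolding V_def by (intro sum.cong arg_cong[where f = f]) auto
    \<comment> \<open>The \<open>w\<close> outside the class of \<open>x\<close> rebuild
      \<open>f V\<close> exactly; the at most \<open>c\<close> others add at most
      \<open>f V / D\<close> each.\<close>
    also have "\<dots> \<le> (\<Sum>w\<in>{w\<in>V. cl w \<noteq> cl x} \<union> {w\<in>V - {x}. cl w = cl x}. f (V - {x, w}))"
      using finV by (intro sum_mono2) (auto simp: V_def f_nonneg)
    also have "\<dots> = (\<Sum>w\<in>{w\<in>V. cl w \<noteq> cl x}. f (V - {x, w})) + (\<Sum>w\<in>{w\<in>V - {x}. cl w = cl x}. f (V - {x, w}))"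
      using finV by (intro sum.union_disjoint) auto
    also have "(\<Sum>w\<in>{w\<in>V. cl w \<noteq> cl x}. f (V - {x, w})) = f V"
      using finV xV by (intro rec[symmetric])
    also have "(\<Sum>w\<in>{w\<in>V - {x}. cl w = cl x}. f (V - {x, w})) \<le> (\<Sum>w\<in>{w\<in>V - {x}. cl w = cl x}. f V / D)"
      by (intro sum_mono close) auto
    also have "\<dots> = card {w\<in>V - {x}. cl w = cl x} * (f V / D)"
      by simp
    also have "\<dots> \<le> real c * (f V / D)"
    proof (intro mult_right_mono)
      have "card {w\<in>V - {x}. cl w = cl x} \<le> card {w\<in>V. cl w = cl x}"
        using finV by (intro card_mono) auto
      then show "real (card {w\<in>V - {x}. cl w = cl x}) \<le> real c"
        using cV[of x] by linarith
    qed (use D f_nonneg in auto)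
    finally show ?thesis by (simp add: algebra_simps)
  qed
  have "f W = (\<Sum>x\<in>{x\<in>W. cl x \<noteq> cl a}. f (W - {a, x}))"
    using fin ab by (intro rec)
  also have "\<dots> \<le> (\<Sum>x\<in>{x\<in>W. cl x \<noteq> cl a}. (1 + real c / D) * f V)"
    by (intro sum_mono step) auto
  also have "\<dots> = card {x\<in>W. cl x \<noteq> cl a} * ((1 + real c / D) * f V)"
    by simp
  also have "\<dots> \<le> card W * ((1 + real c / D) * f V)"
    using fin D by (intro mult_right_mono) (auto intro!: card_mono mult_nonneg_nonneg f_nonneg)
  finally show ?thesis by (simp add: f_def V_def mult.assoc)
qed

text \<open>Peel off the edges of \<open>S\<close> one by one. Before each deletion the remaining
  vertex set is large enough for both ratio bounds with the same \<open>D\<close>, so every edge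
  contributes one factor.\<close>

lemma pm_class_graph_remove_matching:
  fixes cl :: "'a \<Rightarrow> 'b"
  assumes fin: "finite W" and c: "\<And>x. card {y\<in>W. cl y = cl x} \<le> c"
    and S: "finite S" "S \<subseteq> edges (class_graph cl W)" "disjoint S"
    and D: "D > 0" "D + 2 * real (card S) + 2 * real c + 2 \<le> real (card W)"
  shows "D ^ card S * real (pm (class_graph cl (W - \<Union>S))) \<le> real (pm (class_graph cl W))"
    and "real (pm (class_graph cl W))
      \<le> (real (card W) * (1 + real c / D)) ^ card S * real (pm (class_graph cl (W - \<Union>S)))"
proof -
  define f where "f X = real (pm (class_graph cl X))" for X
  define E where "E = real (card W) * (1 + real c / D)"
  have E: "E \<ge> 0" using D by (simp add: E_def)
  have "D ^ card S * f (W - \<Union>S) \<le> f W \<and> f W \<le> E ^ card S * f (W - \<Union>S)"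
    using S D(2)
  proof (induction S rule: finite_induct)
    case empty
    then show ?case by simp
  next
    case (insert e S)
    let ?V = "W - \<Union>S"
    have S: "S \<subseteq> edges (class_graph cl W)" "disjoint S"
      using insert.prems by (auto simp: disjoint_def)
    have IH: "D ^ card S * f ?V \<le> f W" "f W \<le> E ^ card S * f ?V"
      using insert.IH[OF S] insert.prems(3) insert.hyps by auto
    have sub: "\<Union>S \<subseteq> W" using S(1) by (auto simp: edges_class_graph)
    have "e \<noteq> e'" "e \<inter> e' = {}" if "e' \<in> S" for e'
      using insert.prems(2) insert.hyps that by (auto simp: disjoint_def)
    then have "e \<in> edges (class_graph cl ?V)"
      unfolding edges_class_graph_Diff using insert.prems(1) by auto
    then obtain a b where e: "e = {a, b}" "a \<in> ?V" "b \<in> ?V" "cl a \<noteq> cl b"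
      unfolding edges_class_graph by blast
    have cV: "card {y\<in>?V. cl y = cl x} \<le> c" for x
      by (rule order_trans[OF card_mono c[of x]]) (use fin in auto)
    have finV: "finite ?V" using fin by simp
    have "card ?V = card W - 2 * card S"
      using card_Union_disjoint_edges[OF simple_class_graph[OF fin] S] sub fin
      by (subst card_Diff_subset) (auto intro: finite_subset)
    moreover have "card (insert e S) = card S + 1" using insert.hyps by simp
    \<comment> \<open>The edge \<open>e\<close> counts for 2 in the size hypothesis; with the
      constant 2 this gives the 4 that \<open>pm_class_graph_le_remove_edge\<close>
      requires.\<close>
    ultimately have cardV: "D + 4 + 2 * real c \<le> card ?V" "card ?V \<le> card W"
      using insert.prems(3) by linarith+
    have V: "?V - {a, b} = W - \<Union>(insert e S)" using e by auto
    have "D * f (?V - {a, b}) \<le> (real (card ?V) - 2 - 2 * real c) * f (?V - {a, b})"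
      using cardV by (intro mult_right_mono) (auto simp: f_def)
    also have "\<dots> \<le> f ?V"
      unfolding f_def using e by (intro pm_class_graph_remove_two_le finV cV) auto
    finally have 1: "D * f (?V - {a, b}) \<le> f ?V" .
    have "f ?V \<le> real (card ?V) * (1 + real c / D) * f (?V - {a, b})"
      unfolding f_def using e D cardV by (intro pm_class_graph_le_remove_edge finV cV) auto
    also have "\<dots> \<le> E * f (?V - {a, b})"
      unfolding E_def using cardV D by (intro mult_right_mono) (auto simp: f_def)
    finally have 2: "f ?V \<le> E * f (?V - {a, b})" .
    have "D ^ card S * (D * f (?V - {a, b})) \<le> f W"
      by (rule order_trans[OF mult_left_mono[OF 1] IH(1)]) (use D in simp)
    moreover have "f W \<le> E ^ card S * (E * f (?V - {a, b}))"
      by (rule order_trans[OF IH(2) mult_left_mono[OF 2]]) (use E in simp)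
    ultimately show ?case
      using insert.hyps by (simp only: V) (simp add: mult_ac)
  qed
  then show "D ^ card S * real (pm (class_graph cl (W - \<Union>S))) \<le> real (pm (class_graph cl W))"
    and "real (pm (class_graph cl W))
      \<le> (real (card W) * (1 + real c / D)) ^ card S * real (pm (class_graph cl (W - \<Union>S)))"
    by (auto simp: f_def E_def)
qed

section \<open>Binomial moments, Bonferroni inequalities and limits\<close>

text \<open>Double counting of the pairs of a member \<open>P\<close> and a \<open>k\<close>-subset
  \<open>S\<close> of \<open>P \<inter> M\<close>.\<close>

lemma sum_choose_card_Int:
  assumes "finite \<P>" "finite M"
  shows "(\<Sum>P\<in>\<P>. card (P \<inter> M) choose k)
    = (\<Sum>S\<in>{S. S \<subseteq> M \<and> card S = k}. card {P\<in>\<P>. S \<subseteq> P})"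
proof -
  let ?S = "{S. S \<subseteq> M \<and> card S = k}"
  have fin: "finite ?S" using assms by simp
  have "(\<Sum>P\<in>\<P>. card (P \<inter> M) choose k) = (\<Sum>P\<in>\<P>. card {S\<in>?S. S \<subseteq> P})"
  proof (rule sum.cong)
    fix P
    have "card (P \<inter> M) choose k = card {S. S \<subseteq> P \<inter> M \<and> card S = k}"
      using assms by (intro n_subsets[symmetric]) simp
    also have "{S. S \<subseteq> P \<inter> M \<and> card S = k} = {S\<in>?S. S \<subseteq> P}" by auto
    finally show "card (P \<inter> M) choose k = card {S\<in>?S. S \<subseteq> P}" .
  qed simp
  also have "\<dots> = (\<Sum>S\<in>?S. card {P\<in>\<P>. S \<subseteq> P})"
    using sum.swap_restrict[OF assms(1) fin, of "\<lambda>_ _. 1::nat" "\<lambda>P S. S \<subseteq> P"] by simp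
  finally show ?thesis .
qed

text \<open>For positive \<open>m\<close> and \<open>K\<close>, the sum over all
  \<open>k < K\<close> cancels the indicator 0 up to \<open>(m - 1) choose (K - 1)\<close> in
  absolute value, which Pascal's rule bounds by \<open>m choose K\<close>.\<close>

lemma bonferroni_choose:
  "\<bar>(if m = 0 then 1 else 0) - (\<Sum>k<K. (-1) ^ k * real (m choose k))\<bar> \<le> real (m choose K)"
proof (cases "m = 0 \<or> K = 0")
  case True
  then show ?thesis
  proof (cases K)
    case (Suc J)
    then have "(\<Sum>k<K. (-1) ^ k * real (0 choose k)) = 1"
      by (simp only: sum.lessThan_Suc_shift) simp
    then show ?thesis using True Suc by auto
  qed auto
next
  case False
  then obtain n J where nJ: "m = Suc n" "K = Suc J"
    by (meson not0_implies_Suc)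
  have "(\<Sum>k\<le>J. (-1) ^ k * real (Suc n choose k)) = (-1) ^ J * real (n choose J)"
    using gbinomial_sum_lower_neg[of "real (Suc n)" J] by (simp add: binomial_gbinomial mult.commute)
  moreover have "n choose J \<le> Suc n choose Suc J" by simp
  ultimately show ?thesis
    by (simp add: nJ lessThan_Suc_atMost abs_mult del: binomial_Suc_Suc sum.lessThan_Suc)
qed

text \<open>With \<open>k\<close> fixed, the quotient is a product of \<open>k\<close> factors
  \<open>(n - i) / n\<close>, each tending to 1, over \<open>fact k\<close>.\<close>

lemma tendsto_choose_over_power:
  "(\<lambda>n. real (n choose k) / real n ^ k) \<longlonglongrightarrow> 1 / fact k"
proof -
  have "(\<lambda>n. (\<Prod>i<k. (real n - real i) / real n) / fact k) \<longlonglongrightarrow> (\<Prod>i<k. 1) / fact k"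
    by (intro tendsto_intros) (real_asymp | simp)+
  moreover have "(\<Prod>i<k. (real n - real i) / real n) / fact k = real (n choose k) / real n ^ k" for n
    by (simp add: binomial_gbinomial gbinomial_prod_rev prod_dividef atLeast0LessThan)
  ultimately show ?thesis by simp
qed

text \<open>Interchange of limits: for fixed \<open>K\<close> the truncation error is bounded in the
  limit by \<open>t K\<close>, which is small for large \<open>K\<close> since the terms of a
  convergent series vanish.\<close>

lemma tendsto_alternating_bounded_error:
  fixes T :: "nat \<Rightarrow> 'a \<Rightarrow> real"
  assumes T: "\<And>k. (T k \<longlongrightarrow> t k) F"
    and q: "\<And>K. \<forall>\<^sub>F n in F. \<bar>q n - (\<Sum>k<K. (-1) ^ k * T k n)\<bar> \<le> T K n"
    and s: "(\<lambda>k. (-1) ^ k * t k) sums s"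
  shows "(q \<longlongrightarrow> s) F"
proof (rule tendstoI)
  fix e :: real assume e: "e > 0"
  have "(\<lambda>k. \<bar>(-1) ^ k * t k\<bar>) \<longlonglongrightarrow> 0"
    using s by (intro tendsto_rabs_zero summable_LIMSEQ_zero sums_summable)
  then have "\<forall>\<^sub>F K in sequentially. \<bar>t K\<bar> < e / 4"
    using e by (intro order_tendstoD(2)) (auto simp: abs_mult)
  moreover have "\<forall>\<^sub>F K in sequentially. dist (\<Sum>k<K. (-1) ^ k * t k) s < e / 4"
    using s e by (intro tendstoD) (auto simp: sums_def)
  ultimately have "\<forall>\<^sub>F K in sequentially. \<bar>t K\<bar> < e / 4 \<and> dist (\<Sum>k<K. (-1) ^ k * t k) s < e / 4"
    by (rule eventually_conj)
  \<comment> \<open>Budget for \<open>e\<close>: two quarters bound \<open>T K n\<close> through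
    \<open>t K\<close>, one compares the two truncated sums, one bounds the tail of the
    series.\<close>
  then obtain K where K: "\<bar>t K\<bar> < e / 4" "dist (\<Sum>k<K. (-1) ^ k * t k) s < e / 4"
    by (auto simp: eventually_sequentially)
  have "\<forall>\<^sub>F n in F. dist (T K n) (t K) < e / 4"
    using T e by (intro tendstoD) auto
  moreover have "\<forall>\<^sub>F n in F. dist (\<Sum>k<K. (-1) ^ k * T k n) (\<Sum>k<K. (-1) ^ k * t k) < e / 4"
    using e by (intro tendstoD tendsto_intros T) auto
  ultimately show "\<forall>\<^sub>F n in F. dist (q n) s < e"
    using q[of K]
  proof eventually_elim
    case (elim n)
    then show ?case using K unfolding dist_real_def by linarith
  qed
qed

text \<open>Matchings of the reduced graph are those \<open>P\<close> with
  \<open>card (P \<inter> M) = 0\<close>, an indicator to which \<open>bonferroni_choose\<close>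
  applies for each \<open>P\<close> separately.\<close>

lemma pm_remove_edges_bonferroni:
  assumes "simple_graph G" "finite M"
  shows "\<bar>real (pm (remove_edges G M))
      - (\<Sum>k<K. (-1) ^ k * (\<Sum>P\<in>{P. perfect_matching G P}. real (card (P \<inter> M) choose k)))\<bar>
    \<le> (\<Sum>P\<in>{P. perfect_matching G P}. real (card (P \<inter> M) choose K))"
proof -
  let ?P = "{P. perfect_matching G P}"
  have fin: "finite ?P" using assms(1) by (rule finite_perfect_matchings)
  have "{P. perfect_matching (remove_edges G M) P} = {P\<in>?P. card (P \<inter> M) = 0}"
    using assms(2) by (auto simp: perfect_matching_def remove_edges_def)
  then have "real (pm (remove_edges G M)) = (\<Sum>P\<in>?P. if card (P \<inter> M) = 0 then 1 else 0)"
    unfolding pm_def using sum.inter_filter[OF fin, of "\<lambda>_. 1::real" "\<lambda>P. card (P \<inter> M) = 0"]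
    by simp
  moreover have "(\<Sum>k<K. (-1) ^ k * (\<Sum>P\<in>?P. real (card (P \<inter> M) choose k)))
      = (\<Sum>P\<in>?P. \<Sum>k<K. (-1) ^ k * real (card (P \<inter> M) choose k))"
    unfolding sum_distrib_left by (rule sum.swap)
  ultimately have "\<bar>real (pm (remove_edges G M))
      - (\<Sum>k<K. (-1) ^ k * (\<Sum>P\<in>?P. real (card (P \<inter> M) choose k)))\<bar>
    = \<bar>\<Sum>P\<in>?P. (if card (P \<inter> M) = 0 then 1 else 0) - (\<Sum>k<K. (-1) ^ k * real (card (P \<inter> M) choose k))\<bar>"
    by (simp only: sum_subtractf)
  also have "\<dots> \<le> (\<Sum>P\<in>?P. real (card (P \<inter> M) choose K))"
    by (rule order_trans[OF sum_abs]) (intro sum_mono bonferroni_choose)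
  finally show ?thesis .
qed

section \<open>Asymptotic moments and the Poisson limit\<close>

text \<open>The quotient is the \<open>k\<close>-th binomial moment of the number of edges that a
  random perfect matching shares with \<open>M\<close>. Each \<open>k\<close>-subset of
  \<open>M\<close> contributes its probability of being contained, bounded by
  \<open>pm_class_graph_remove_matching\<close>.\<close>

lemma sum_choose_perfect_matching_bounds:
  fixes cl :: "'a \<Rightarrow> 'b" and k :: nat
  assumes fin: "finite W" and c: "\<And>x. card {y\<in>W. cl y = cl x} \<le> c"
    and M: "perfect_matching (class_graph cl W) M"
    and n: "card W = 2 * n"
    and D: "D > 0" "D + 2 * real k + 2 * real c + 2 \<le> 2 * real n"
  defines "T \<equiv> (\<Sum>P\<in>{P. perfect_matching (class_graph cl W) P}. real (card (P \<inter> M) choose k))"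
  shows "real (n choose k) / (2 * real n * (1 + real c / D)) ^ k \<le> T / real (pm (class_graph cl W))"
    and "T / real (pm (class_graph cl W)) \<le> real (n choose k) / D ^ k"
proof -
  let ?G = "class_graph cl W"
  let ?S = "{S. S \<subseteq> M \<and> card S = k}"
  define f where "f X = real (pm (class_graph cl X))" for X
  define E where "E = 2 * real n * (1 + real c / D)"
  have sg: "simple_graph ?G" using fin by (rule simple_class_graph)
  have finM: "finite M" and dM: "disjoint M" and ME: "M \<subseteq> edges ?G"
    using finite_perfect_matching[OF sg M] perfect_matching_disjoint[OF sg M] M
    by (auto simp: perfect_matching_def)
  have "card M = n"
    using card_Union_disjoint_edges[OF sg ME dM] Union_perfect_matching[OF sg M] n by simp
  then have cardS: "card ?S = n choose k"
    using finM by (simp add: n_subsets)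
  have "n > 0" using D by linarith
  then have E: "E > 0" using D(1) by (simp add: E_def add_pos_nonneg)
  \<comment> \<open>\<open>M\<close> itself is a perfect matching, so the denominator is
    positive.\<close>
  have pos: "f W > 0"
    using M finite_perfect_matchings[OF sg] by (auto simp: f_def pm_def card_gt_0_iff)
  have S: "finite S \<and> S \<subseteq> edges ?G \<and> disjoint S" if "S \<in> ?S" for S
    using that finM dM ME by (auto simp: disjoint_def intro: finite_subset)
  have "T = real (\<Sum>P\<in>{P. perfect_matching ?G P}. card (P \<inter> M) choose k)"
    by (simp add: T_def)
  also have "\<dots> = (\<Sum>S\<in>?S. real (card {P. perfect_matching ?G P \<and> S \<subseteq> P}))"
    using finite_perfect_matchings[OF sg] finM by (simp add: sum_choose_card_Int)
  also have "\<dots> = (\<Sum>S\<in>?S. f (W - \<Union>S))"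
    using S fin by (intro sum.cong) (auto simp: f_def card_perfect_matchings_containing)
  finally have T: "T = (\<Sum>S\<in>?S. f (W - \<Union>S))" .
  have bounds: "f W / E ^ k \<le> f (W - \<Union>S)" "f (W - \<Union>S) \<le> f W / D ^ k" if "S \<in> ?S" for S
  proof -
    have "D + 2 * real (card S) + 2 * real c + 2 \<le> real (card W)"
      using that D(2) n by simp
    then have "D ^ k * f (W - \<Union>S) \<le> f W" "f W \<le> E ^ k * f (W - \<Union>S)"
      using pm_class_graph_remove_matching[where cl = cl, OF fin c, of S D] S[OF that] that D(1) n
      by (auto simp: f_def E_def)
    then show "f W / E ^ k \<le> f (W - \<Union>S)" "f (W - \<Union>S) \<le> f W / D ^ k"
      using E D(1) by (auto simp: field_simps)
  qed
  have "real (n choose k) * (f W / E ^ k) \<le> T"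
    using sum_mono[of ?S "\<lambda>_. f W / E ^ k" "\<lambda>S. f (W - \<Union>S)"] bounds(1) cardS T by simp
  then have "real (n choose k) / E ^ k \<le> T / f W"
    using pos by (simp add: field_simps)
  then show "real (n choose k) / (2 * real n * (1 + real c / D)) ^ k \<le> T / real (pm ?G)"
    by (simp add: E_def f_def)
  have "T \<le> real (n choose k) * (f W / D ^ k)"
    using sum_mono[of ?S "\<lambda>S. f (W - \<Union>S)" "\<lambda>_. f W / D ^ k"] bounds(2) cardS T by simp
  then have "T / f W \<le> real (n choose k) / D ^ k"
    using pos by (simp add: field_simps)
  then show "T / real (pm ?G) \<le> real (n choose k) / D ^ k"
    by (simp add: f_def)
qed

theorem corollary9:
  fixes c :: nat and M :: "nat \<Rightarrow> (nat \<times> nat) set set"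
  assumes "c > 0"
    and "\<And>n. n > 0 \<Longrightarrow> c dvd 2 * n \<Longrightarrow> 2 * n div c \<ge> 2 \<Longrightarrow>
           perfect_matching (complete_multipartite (2 * n div c) c) (M n)"
  shows "((\<lambda>n. real (pm (remove_edges (complete_multipartite (2 * n div c) c) (M n)))
                / real (pm (complete_multipartite (2 * n div c) c)))
          \<longlongrightarrow> exp (- 1 / 2)) (inf sequentially (principal {n. c dvd 2 * n}))"
proof -
  define F where "F = inf sequentially (principal {n. c dvd 2 * n})"
  define W where "W n = {..<2 * n div c} \<times> {..<c}" for n
  define G where "G n = class_graph fst (W n)" for n
  define T where "T k n = (\<Sum>P\<in>{P. perfect_matching (G n) P}. real (card (P \<inter> M n) choose k))
    / real (pm (G n))" for k n
  have G: "complete_multipartite (2 * n div c) c = G n" for n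
    by (simp add: G_def W_def complete_multipartite_eq_class_graph)
  have finW: "finite (W n)" for n by (simp add: W_def)
  have sg: "simple_graph (G n)" for n unfolding G_def by (intro simple_class_graph finW)
  have classes: "card {y\<in>W n. fst y = fst x} \<le> c" for n x
  proof -
    have "{y\<in>W n. fst y = fst x} \<subseteq> {fst x} \<times> {..<c}" by (auto simp: W_def)
    then have "card {y\<in>W n. fst y = fst x} \<le> card ({fst x} \<times> {..<c})" by (intro card_mono) auto
    then show ?thesis by simp
  qed
  have F_le: "F \<le> sequentially" by (simp add: F_def)
  have ev: "\<forall>\<^sub>F n in F. perfect_matching (G n) (M n) \<and> card (W n) = 2 * n"
    unfolding F_def eventually_inf_principal
    \<comment> \<open>\<open>n \<ge> c\<close> ensures at least two classes; divisibility makes the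
      classes hold exactly \<open>2 * n\<close> vertices.\<close>
    using eventually_ge_at_top[of c]
  proof eventually_elim
    case (elim n)
    show ?case
    proof
      assume "n \<in> {n. c dvd 2 * n}"
      moreover have "2 \<le> 2 * n div c"
        using assms(1) elim div_le_mono[of "2 * c" "2 * n" c] by simp
      ultimately show "perfect_matching (G n) (M n) \<and> card (W n) = 2 * n"
        using assms elim by (auto simp: G[symmetric] W_def)
    qed
  qed
  have lim: "(T k \<longlongrightarrow> (1 / 2) ^ k / fact k) F" for k
  proof (rule tendsto_sandwich)
    \<comment> \<open>The largest value that \<open>sum_choose_perfect_matching_bounds\<close>
      admits. As \<open>k\<close> and \<open>c\<close> are fixed, \<open>D n / (2 * n)\<close> tends
      to 1 and both bounds share one limit.\<close>
    define D where "D n = 2 * real n - 2 * real k - 2 * real c - 2" for n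
    define lo where "lo n = real (n choose k) / (2 * real n * (1 + real c / D n)) ^ k" for n
    define hi where "hi n = real (n choose k) / D n ^ k" for n
    have "\<forall>\<^sub>F n in sequentially. D n > 0"
      unfolding D_def by real_asymp
    then have "\<forall>\<^sub>F n in F. D n > 0"
      using F_le by (rule filter_leD[rotated])
    then have "\<forall>\<^sub>F n in F. lo n \<le> T k n \<and> T k n \<le> hi n"
      using ev
    proof eventually_elim
      case (elim n)
      then show ?case
        unfolding lo_def hi_def T_def G_def
        by (intro conjI sum_choose_perfect_matching_bounds[where c = c] finW classes) (auto simp: D_def)
    qed
    then show "\<forall>\<^sub>F n in F. lo n \<le> T k n" "\<forall>\<^sub>F n in F. T k n \<le> hi n"
      by (auto elim: eventually_mono)
    have "(\<lambda>n. real (n choose k) / real n ^ k * (1 / (2 * (1 + real c / D n))) ^ k)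
        \<longlonglongrightarrow> 1 / fact k * (1 / 2) ^ k"
      unfolding D_def by (intro tendsto_mult tendsto_power tendsto_choose_over_power) real_asymp
    then have "lo \<longlonglongrightarrow> (1 / 2) ^ k / fact k"
      by (simp add: lo_def[abs_def] power_mult_distrib power_divide mult_ac)
    then show "(lo \<longlongrightarrow> (1 / 2) ^ k / fact k) F"
      using F_le by (rule tendsto_mono[rotated])
    have "(\<lambda>n. real (n choose k) / real n ^ k * (real n / D n) ^ k) \<longlonglongrightarrow> 1 / fact k * (1 / 2) ^ k"
      unfolding D_def by (intro tendsto_mult tendsto_power tendsto_choose_over_power) real_asymp
    moreover have "\<forall>\<^sub>F n in sequentially.
        real (n choose k) / real n ^ k * (real n / D n) ^ k = hi n"
      using eventually_gt_at_top[of 0] by eventually_elim (simp add: hi_def power_divide)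
    ultimately have "hi \<longlonglongrightarrow> (1 / 2) ^ k / fact k"
      by (simp add: tendsto_cong)
    then show "(hi \<longlongrightarrow> (1 / 2) ^ k / fact k) F"
      using F_le by (rule tendsto_mono[rotated])
  qed
  have error: "\<forall>\<^sub>F n in F. \<bar>real (pm (remove_edges (G n) (M n))) / real (pm (G n))
      - (\<Sum>k<K. (-1) ^ k * T k n)\<bar> \<le> T K n" for K
    using ev
  proof eventually_elim
    case (elim n)
    let ?B = "\<lambda>k. \<Sum>P\<in>{P. perfect_matching (G n) P}. real (card (P \<inter> M n) choose k)"
    have "real (pm (remove_edges (G n) (M n))) / real (pm (G n)) - (\<Sum>k<K. (-1) ^ k * T k n)
        = (real (pm (remove_edges (G n) (M n))) - (\<Sum>k<K. (-1) ^ k * ?B k)) / real (pm (G n))"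
      by (simp only: T_def diff_divide_distrib sum_divide_distrib[of _ "{..<K}"] times_divide_eq_right)
    then have "\<bar>real (pm (remove_edges (G n) (M n))) / real (pm (G n)) - (\<Sum>k<K. (-1) ^ k * T k n)\<bar>
        = \<bar>real (pm (remove_edges (G n) (M n))) - (\<Sum>k<K. (-1) ^ k * ?B k)\<bar> / real (pm (G n))"
      by simp
    also have "\<dots> \<le> ?B K / real (pm (G n))"
      using elim finite_perfect_matching[OF sg]
      by (intro divide_right_mono pm_remove_edges_bonferroni sg) auto
    finally show ?case by (simp add: T_def)
  qed
  \<comment> \<open>The alternating sum of the limiting moments is the exponential series at
    \<open>- 1 / 2\<close>.\<close>
  have "(\<lambda>k. (-1) ^ k * ((1 / 2) ^ k / fact k)) sums exp (- 1 / 2 :: real)"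
  proof -
    have "(-1) ^ k * ((1 / 2) ^ k / fact k) = (- 1 / 2 :: real) ^ k /\<^sub>R fact k" for k
      using power_mult_distrib[of "-1" "1 / 2 :: real" k] by (simp add: field_simps)
    then show ?thesis using exp_converges[of "- 1 / 2 :: real"] by simp
  qed
  with lim error show ?thesis
    unfolding G F_def[symmetric] by (rule tendsto_alternating_bounded_error)
qed

end
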